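(* Let $b=b(n)\ge 1$ and $k=k(n)\ge 2$ be integer-valued functions that are both subpolynomial in $n$. Then, as $n\to\infty$, $$\tau(\mathcal{COL}_{n,k},b)=(1+o(1))\log_{b+1}(n),$$ where $\mathcal{COL}_{n,k}$ is the hypergraph with vertex set $E(K_n)$ whose hyperedges are the edge sets of all subgraphs of $K_n$ with chromatic number larger than $k$.
   Context: A function $f(n)$ is subpolynomial in $n$ if $f(n)=o(n^{\varepsilon})$ for all $\varepsilon>0$. Multistage $(1:b)$ Maker-Breaker game on a hypergraph $\mathcal{H}=(\mathcal{X},\mathcal{F})$ (board $\mathcal{X}$, family of winning sets $\mathcal{F}$), $b\ge 1$ an integer: Put $\mathcal{X}_0:=\mathcal{X}$, $\mathcal{F}_0:=\mathcal{F}$. For $i\ge 1$, in Stage $i$ Maker and Breaker play on the board $\mathcal{X}_{i-1}$, alternating in turns in which Maker claims exactly one unclaimed element of $\mathcal{X}_{i-1}$ and afterwards Breaker claims up to $b$ unclaimed elements of $\mathcal{X}_{i-1}$, with Maker moving first. Once all elements of $\mathcal{X}_{i-1}$ have been distributed among the players, $\mathcal{X}_i\subseteq\mathcal{X}_{i-1}$ denotes the set of all elements claimed by Maker in Stage $i$, and $\mathcal{F}_i:=\{F\in\mathcal{F}_{i-1}: F\subseteq\mathcal{X}_i\}$. The game stops the first time no winning sets are left. The threshold parameter $\tau(\mathcal{H},b)$ is the largest number $s$ such that Maker has a strategy (against every play of Breaker) ensuring $\mathcal{F}_s\neq\varnothing$. *)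

theory Defs
  imports Complex_Main "HOL-Library.Landau_Symbols"
begin

section \<open>Multistage Maker-Breaker games\<close>

text \<open>A hypergraph is a pair of a board and a family of winning sets. Boards are meant to be finite.\<close>

type_synonym 'a hypergraph = "'a set \<times> 'a set set"

text \<open>A round consists of the element claimed by Maker and the set of elements with which Breaker
  answers. The transcript of a (possibly unfinished) stage is the list of its rounds, and the
  history of the game is the list of the transcripts of all finished stages, in the order of play.\<close>

type_synonym 'a round = "'a \<times> 'a set"
type_synonym 'a stage = "'a round list"
type_synonym 'a history = "'a stage list"

definition maker_set :: "'a stage \<Rightarrow> 'a set" where
  "maker_set rs = fst ` set rs"

definition breaker_set :: "'a stage \<Rightarrow> 'a set" where
  "breaker_set rs = \<Union> (snd ` set rs)"

definition unclaimed :: "'a set \<Rightarrow> 'a stage \<Rightarrow> 'a set" where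
  "unclaimed X rs = X - (maker_set rs \<union> breaker_set rs)"

definition current_board :: "'a hypergraph \<Rightarrow> 'a history \<Rightarrow> 'a set" where
  "current_board H h = (if h = [] then fst H else maker_set (last h))"

definition current_winning_sets :: "'a hypergraph \<Rightarrow> 'a history \<Rightarrow> 'a set set" where
  "current_winning_sets H h = fold (\<lambda>rs \<F>. {F \<in> \<F>. F \<subseteq> maker_set rs}) h (snd H)"

text \<open>A strategy of Maker may depend on everything played so far, in earlier stages and in the
  current one. It has to prescribe a legal move whenever there is an unclaimed element; otherwise
  Maker could profit from getting a stage stuck.\<close>

type_synonym 'a strategy = "'a history \<Rightarrow> 'a stage \<Rightarrow> 'a"

definition legal_strategy :: "'a hypergraph \<Rightarrow> 'a strategy \<Rightarrow> bool" where
  "legal_strategy H \<sigma> \<longleftrightarrow>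
     (\<forall>h rs. unclaimed (current_board H h) rs \<noteq> {} \<longrightarrow>
             \<sigma> h rs \<in> unclaimed (current_board H h) rs)"

text \<open>The partial plays of a single stage on the board \<open>X\<close> in which Maker follows \<open>\<mu>\<close> and Breaker
  plays arbitrarily subject to the bias \<open>b\<close>.\<close>

inductive stage_play :: "nat \<Rightarrow> 'a set \<Rightarrow> ('a stage \<Rightarrow> 'a) \<Rightarrow> 'a stage \<Rightarrow> bool"
  for b :: nat and X :: "'a set" and \<mu> :: "'a stage \<Rightarrow> 'a" where
  start: "stage_play b X \<mu> []"
| turn: "stage_play b X \<mu> rs \<Longrightarrow> m = \<mu> rs \<Longrightarrow> m \<in> unclaimed X rs \<Longrightarrow>
         B \<subseteq> unclaimed X rs - {m} \<Longrightarrow> finite B \<Longrightarrow> card B \<le> b \<Longrightarrow>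
         stage_play b X \<mu> (rs @ [(m, B)])"

text \<open>The histories that can arise when Maker follows \<open>\<sigma>\<close>. A new stage is only
  played if there are winning sets left, and it ends once its whole board has been distributed.\<close>

inductive game_play :: "'a hypergraph \<Rightarrow> nat \<Rightarrow> 'a strategy \<Rightarrow> 'a history \<Rightarrow> bool"
  for H :: "'a hypergraph" and b :: nat and \<sigma> :: "'a strategy" where
  start: "game_play H b \<sigma> []"
| stage: "game_play H b \<sigma> h \<Longrightarrow> current_winning_sets H h \<noteq> {} \<Longrightarrow>
          stage_play b (current_board H h) (\<sigma> h) rs \<Longrightarrow>
          unclaimed (current_board H h) rs = {} \<Longrightarrow>
          game_play H b \<sigma> (h @ [rs])"

text \<open>Histories shorter than \<open>s\<close> are included since the game may stop before Stage \<open>s\<close>, in which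
  case Maker has failed.\<close>

definition maker_can_ensure :: "'a hypergraph \<Rightarrow> nat \<Rightarrow> nat \<Rightarrow> bool" where
  "maker_can_ensure H b s \<longleftrightarrow>
     (\<exists>\<sigma>. legal_strategy H \<sigma> \<and>
          (\<forall>h. game_play H b \<sigma> h \<and> length h \<le> s \<longrightarrow> current_winning_sets H h \<noteq> {}))"

text \<open>Unspecified if there is no largest such number, i.e. if there are no winning sets at all or
  if Maker can keep a winning set forever (e.g. one with at most one element).\<close>

definition threshold :: "'a hypergraph \<Rightarrow> nat \<Rightarrow> nat" (\<open>\<tau>\<close>) where
  "\<tau> H b = (GREATEST s. maker_can_ensure H b s)"


section \<open>The colourability hypergraph\<close>

definition complete_edges :: "'v set \<Rightarrow> 'v set set" where
  "complete_edges V = {{u, v} | u v. u \<in> V \<and> v \<in> V \<and> u \<noteq> v}"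

definition proper_colouring :: "'v set \<Rightarrow> 'v set set \<Rightarrow> nat \<Rightarrow> ('v \<Rightarrow> nat) \<Rightarrow> bool" where
  "proper_colouring V E c f \<longleftrightarrow>
     (\<forall>v\<in>V. f v < c) \<and> (\<forall>u\<in>V. \<forall>v\<in>V. {u, v} \<in> E \<longrightarrow> f u \<noteq> f v)"

definition chromatic_number :: "'v set \<Rightarrow> 'v set set \<Rightarrow> nat" where
  "chromatic_number V E = (LEAST c. \<exists>f. proper_colouring V E c f)"

text \<open>The vertex set of \<open>K\<^sub>n\<close> is \<open>{..<n}\<close>; a subgraph \<open>(V, E)\<close> need not be spanning.\<close>

definition COL :: "nat \<Rightarrow> nat \<Rightarrow> nat set hypergraph" where
  "COL n k =
     (complete_edges {..<n},
      {E. \<exists>V. V \<subseteq> {..<n} \<and> E \<subseteq> complete_edges V \<and> chromatic_number V E > k})"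


section \<open>Subpolynomial functions\<close>

definition subpolynomial :: "(nat \<Rightarrow> nat) \<Rightarrow> bool" where
  "subpolynomial f \<longleftrightarrow> (\<forall>\<epsilon>::real. \<epsilon> > 0 \<longrightarrow> (\<lambda>n. real (f n)) \<in> o(\<lambda>n. real n powr \<epsilon>))"

end

theory Submission imports Defs begin

text \<open>
  Upper bound: Breaker assigns every edge to its larger endpoint and answers each move of Maker inside
  the same class. This divides the class sizes by \<open>b + 1\<close> (rounded up) in every stage, so after
  \<open>\<lceil>log\<^bsub>b+1\<^esub> n\<rceil>\<close> stages every vertex has at most one smaller neighbour and Maker's graph is
  2-colourable.

  Lower bound: it suffices that Maker keeps an edge inside every set \<open>A\<close> of \<open>r = \<lceil>n / k\<rceil>\<close> vertices, for
  then no colour class of a \<open>k\<close>-colouring can be large enough. In each stage Maker greedily decreases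
  the potential \<open>\<Sum>\<^sub>F q^(Breaker's edges in F) * (1 - \<mu>)^(Maker's edges in F)\<close> over the edge sets \<open>F\<close> of
  these cliques, where \<open>q^b = 1 + \<mu>\<close>. With \<open>L = ln N / ln (1 + \<mu>)\<close>, where \<open>N \<le> 2^n\<close> is the number of sets, this
  yields the clean recursion \<open>\<bar>F \<inter> X\<^sub>i\<bar> + L \<le> c (b + 1) (\<bar>F \<inter> X\<^sub>i\<^sub>+\<^sub>1\<bar> + L)\<close> with \<open>c\<close> arbitrarily close
  to 1 as \<open>\<mu> \<rightarrow> 0\<close>. Since \<open>\<bar>F\<bar>\<close> has order \<open>(n / k)\<^sup>2\<close> and \<open>L\<close> has order \<open>n\<close>, Maker survives
  \<open>(1 - \<epsilon>) log\<^bsub>b+1\<^esub> n\<close> stages.\<close>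

section \<open>Plays\<close>

lemma maker_set_Nil [simp]: "maker_set [] = {}"
  and breaker_set_Nil [simp]: "breaker_set [] = {}"
  and maker_set_snoc [simp]: "maker_set (rs @ [(m, B)]) = insert m (maker_set rs)"
  and breaker_set_snoc [simp]: "breaker_set (rs @ [(m, B)]) = B \<union> breaker_set rs"
  and finite_maker_set [simp]: "finite (maker_set rs)"
  by (auto simp: maker_set_def breaker_set_def)

lemma stage_playD:
  assumes "stage_play b X \<mu> rs"
  shows "finite (breaker_set rs)" "maker_set rs \<subseteq> X" "breaker_set rs \<subseteq> X"
    "maker_set rs \<inter> breaker_set rs = {}"
  using assms by (induction; force simp: unclaimed_def)+

lemma finite_current_board: "finite (fst H) \<Longrightarrow> finite (current_board H h)"
  by (simp add: current_board_def)

lemma current_board_Nil [simp]: "current_board H [] = fst H"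
  and current_board_snoc [simp]: "current_board H (h @ [rs]) = maker_set rs"
  by (simp_all add: current_board_def)

text \<open>Each new board lies inside the previous one, so the filter of the last stage implies all
  earlier ones. For the empty history the hypothesis on the winning sets is what makes the condition
  vacuous.\<close>

lemma current_winning_sets_eq:
  assumes "game_play H b \<sigma> h" "\<And>F. F \<in> snd H \<Longrightarrow> F \<subseteq> fst H"
  shows "current_winning_sets H h = {F \<in> snd H. F \<subseteq> current_board H h}"
  using assms(1)
proof induction
  case start
  then show ?case using assms(2) by (auto simp: current_winning_sets_def)
next
  case (stage h rs)
  have "current_winning_sets H (h @ [rs]) = {F \<in> current_winning_sets H h. F \<subseteq> maker_set rs}"
    by (simp add: current_winning_sets_def)
  with stage.IH stage_playD(2)[OF stage.hyps(3)] show ?case by auto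
qed

section \<open>Breaker's pairing strategy\<close>

text \<open>The invariant counts an unclaimed element once and an element of Maker
  \<open>b + 1\<close> times. Maker's move raises the count of its class by \<open>b\<close> and
  leaves the other classes alone; Breaker repairs this by taking \<open>b\<close> more elements of
  that class, or all that remain.\<close>

lemma breaker_response:
  fixes p :: "'a \<Rightarrow> 'c"
  assumes "finite X" "m \<in> unclaimed X rs"
    and inv: "\<And>c. card {e \<in> unclaimed X rs. p e = c} + (b + 1) * card {e \<in> maker_set rs. p e = c}
      \<le> (b + 1) * t"
  obtains B where "B \<subseteq> unclaimed X rs - {m}" "finite B" "card B \<le> b"
    "\<And>c. card {e \<in> unclaimed X (rs @ [(m, B)]). p e = c} +
      (b + 1) * card {e \<in> maker_set (rs @ [(m, B)]). p e = c} \<le> (b + 1) * t"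
proof -
  define U where "U = unclaimed X rs"
  define W where "W = {e \<in> U. p e = p m} - {m}"
  have fin: "finite U" using assms(1) by (simp add: U_def unclaimed_def)
  then have finW: "finite W" by (simp add: W_def)
  obtain B where B: "B \<subseteq> W" "card B = min b (card W)"
    using obtain_subset_with_card_n[of "min b (card W)" W] by auto
  have finB: "finite B" using B finW finite_subset by auto
  have U': "unclaimed X (rs @ [(m, B)]) = U - insert m B"
    by (auto simp: U_def unclaimed_def)
  have mM: "m \<in> U" "m \<notin> maker_set rs" using assms(2) by (auto simp: U_def unclaimed_def)
  have "card {e \<in> U - insert m B. p e = c} + (b + 1) * card {e \<in> insert m (maker_set rs). p e = c}
      \<le> (b + 1) * t" for c
  proof (cases "c = p m")
    case False
    then have "{e \<in> U - insert m B. p e = c} = {e \<in> U. p e = c}"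
      "{e \<in> insert m (maker_set rs). p e = c} = {e \<in> maker_set rs. p e = c}"
      using B by (auto simp: W_def)
    then show ?thesis using inv[of c] by (simp add: U_def)
  next
    case True
    have 1: "{e \<in> U - insert m B. p e = c} = W - B" using True by (auto simp: W_def)
    have 2: "{e \<in> insert m (maker_set rs). p e = c} = insert m {e \<in> maker_set rs. p e = c}"
      using True by auto
    have 3: "{e \<in> U. p e = c} = insert m W" using True mM by (auto simp: W_def)
    have "card (insert m W) = Suc (card W)"
      using finW by (subst card_insert_disjoint) (auto simp: W_def)
    then have i: "Suc (card W) + (b + 1) * card {e \<in> maker_set rs. p e = c} \<le> (b + 1) * t"
      using inv[of c] by (simp add: U_def[symmetric] 3)
    \<comment> \<open>For a class that Breaker exhausts: \<open>m\<close> was still unclaimed, so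
      the bound is strict, and as both sides are multiples of \<open>b + 1\<close> there is room for
      one more element of Maker.\<close>
    then have "(b + 1) * card {e \<in> maker_set rs. p e = c} < (b + 1) * t" by linarith
    then have "Suc (card {e \<in> maker_set rs. p e = c}) \<le> t" by (metis Suc_leI mult_less_cancel1)
    then have j: "(b + 1) * Suc (card {e \<in> maker_set rs. p e = c}) \<le> (b + 1) * t"
      by (rule mult_le_mono2)
    have "card (W - B) = card W - min b (card W)"
      using B finB by (simp add: card_Diff_subset)
    moreover have "card (insert m {e \<in> maker_set rs. p e = c}) = Suc (card {e \<in> maker_set rs. p e = c})"
      using mM by simp
    ultimately show ?thesis unfolding 1 2 using i j by (auto simp: min_def split: if_splits)
  qed
  then show ?thesis using B finB that[of B] U' by (auto simp: U_def W_def)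
qed

lemma breaker_stage:
  fixes p :: "'a \<Rightarrow> 'c"
  assumes "finite X" "\<And>rs. unclaimed X rs \<noteq> {} \<Longrightarrow> \<mu> rs \<in> unclaimed X rs"
    and "\<And>c. card {e \<in> X. p e = c} \<le> (b + 1) * t"
  obtains rs where "stage_play b X \<mu> rs" "unclaimed X rs = {}"
    "\<And>c. card {e \<in> maker_set rs. p e = c} \<le> t"
proof -
  let ?I = "\<lambda>rs. \<forall>c. card {e \<in> unclaimed X rs. p e = c} +
      (b + 1) * card {e \<in> maker_set rs. p e = c} \<le> (b + 1) * t"
  \<comment> \<open>Any partial play satisfying the invariant extends to a full stage: every turn
    consumes at least Maker's element.\<close>
  have ext: "\<exists>rs'. stage_play b X \<mu> rs' \<and> ?I rs' \<and> unclaimed X rs' = {}"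
    if "stage_play b X \<mu> rs" "?I rs" for rs
    using that
  proof (induction "card (unclaimed X rs)" arbitrary: rs rule: less_induct)
    case less
    show ?case
    proof (cases "unclaimed X rs = {}")
      case False
      with assms(2) have m: "\<mu> rs \<in> unclaimed X rs" by blast
      obtain B where B: "B \<subseteq> unclaimed X rs - {\<mu> rs}" "finite B" "card B \<le> b" "?I (rs @ [(\<mu> rs, B)])"
        by (rule breaker_response[OF assms(1) m, of p b t]) (use less.prems(2) in blast)+
      have "stage_play b X \<mu> (rs @ [(\<mu> rs, B)])"
        using stage_play.turn[OF less.prems(1) refl m B(1-3)] .
      moreover have "unclaimed X (rs @ [(\<mu> rs, B)]) \<subset> unclaimed X rs"
        using m by (auto simp: unclaimed_def)
      then have "card (unclaimed X (rs @ [(\<mu> rs, B)])) < card (unclaimed X rs)"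
        using assms(1) by (intro psubset_card_mono) (auto simp: unclaimed_def)
      ultimately show ?thesis using less.hyps B(4) by blast
    qed (use less.prems in blast)
  qed
  have "?I []" using assms(3) by (simp add: unclaimed_def)
  from ext[OF stage_play.start this]
  obtain rs where rs: "stage_play b X \<mu> rs" "?I rs" "unclaimed X rs = {}" by blast
  have "card {e \<in> maker_set rs. p e = c} \<le> t" for c
  proof -
    have "(b + 1) * card {e \<in> maker_set rs. p e = c} \<le> (b + 1) * t"
      using rs(2)[rule_format, of c] by linarith
    then show ?thesis by (subst (asm) mult_le_cancel1) simp
  qed
  with rs that show ?thesis by blast
qed

text \<open>Against a fixed \<open>\<sigma>\<close> a single play suffices, built by iterating
  \<open>breaker_stage\<close>; each stage lowers the exponent by one. The assumption
  \<open>win\<close>, to be refuted later, guarantees that the game has not stopped before the next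
  stage.\<close>

lemma breaker_game:
  fixes p :: "'a \<Rightarrow> 'c"
  assumes "finite (fst H)" "legal_strategy H \<sigma>"
    and "\<And>c. card {e \<in> fst H. p e = c} \<le> (b + 1) ^ s" and "i \<le> s"
    and win: "\<And>h. game_play H b \<sigma> h \<Longrightarrow> length h \<le> s \<Longrightarrow> current_winning_sets H h \<noteq> {}"
  shows "\<exists>h. game_play H b \<sigma> h \<and> length h = i \<and>
    (\<forall>c. card {e \<in> current_board H h. p e = c} \<le> (b + 1) ^ (s - i))"
  using \<open>i \<le> s\<close>
proof (induction i)
  case 0
  then show ?case using assms(3) game_play.start[of H b \<sigma>] by (intro exI[of _ "[]"]) simp
next
  case (Suc i)
  then obtain h where h: "game_play H b \<sigma> h" "length h = i"
    "\<And>c. card {e \<in> current_board H h. p e = c} \<le> (b + 1) ^ (s - i)" by auto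
  have "s - i = Suc (s - Suc i)" using Suc.prems by simp
  then have "card {e \<in> current_board H h. p e = c} \<le> (b + 1) * (b + 1) ^ (s - Suc i)" for c
    using h(3)[of c] by simp
  then obtain rs where rs: "stage_play b (current_board H h) (\<sigma> h) rs"
    "unclaimed (current_board H h) rs = {}"
    "\<And>c. card {e \<in> maker_set rs. p e = c} \<le> (b + 1) ^ (s - Suc i)"
    using breaker_stage[OF finite_current_board[OF assms(1), of h], of "\<sigma> h" p b "(b + 1) ^ (s - Suc i)"]
      assms(2) unfolding legal_strategy_def by metis
  have "game_play H b \<sigma> (h @ [rs])"
    using game_play.stage[OF h(1) win[OF h(1)] rs(1,2)] h(2) Suc.prems by simp
  then show ?case using h(2) rs(3) by (intro exI[of _ "h @ [rs]"]) simp
qed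

section \<open>Colourings\<close>

lemma complete_edges_eq: "complete_edges V = {e. e \<subseteq> V \<and> card e = 2}"
  unfolding complete_edges_def card_2_iff by blast

text \<open>Colour the vertices in increasing order. The edges with maximum \<open>n\<close> lead
  from \<open>n\<close> to smaller vertices, and there is at most one, so at most one of the two
  colours is forbidden.\<close>

lemma two_colourable:
  fixes E :: "nat set set"
  assumes "\<And>v. card {e \<in> E. Max e = v} \<le> 1" "finite E" "\<And>e. e \<in> E \<Longrightarrow> card e = 2"
  shows "\<exists>f. proper_colouring {..<n} E 2 f"
proof (induction n)
  case 0
  then show ?case by (simp add: proper_colouring_def)
next
  case (Suc n)
  then obtain f where f: "proper_colouring {..<n} E 2 f" by blast
  have nosing: "{n} \<notin> E" using assms(3)[of "{n}"] by auto
  have uniq: "u = v" if "u < n" "v < n" "{u, n} \<in> E" "{v, n} \<in> E" for u v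
  proof -
    have "{{u, n}, {v, n}} \<subseteq> {e \<in> E. Max e = n}" using that by simp
    then have "card {{u, n}, {v, n}} \<le> card {e \<in> E. Max e = n}" using assms(2) by (intro card_mono) simp_all
    also have "\<dots> \<le> 1" by (rule assms(1))
    finally have "card {{u, n}, {v, n}} \<le> 1" .
    then have "{u, n} = {v, n}" by (simp add: card_insert_if split: if_splits)
    then show ?thesis using that by (auto simp: doubleton_eq_iff)
  qed
  \<comment> \<open>If \<open>n\<close> has a smaller neighbour, it is unique, and
    \<open>1 - f u\<close> swaps the colours 0 and 1.\<close>
  define c where "c = (if \<exists>u<n. {u, n} \<in> E then 1 - f (THE u. u < n \<and> {u, n} \<in> E) else 0)"
  have c: "c \<noteq> f u" if "u < n" "{u, n} \<in> E" for u
  proof -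
    have "(THE u. u < n \<and> {u, n} \<in> E) = u"
      by (rule the_equality) (use that uniq in simp_all)
    moreover have "f u < 2" using f that by (simp add: proper_colouring_def)
    moreover have "c = 1 - f (THE u. u < n \<and> {u, n} \<in> E)"
      unfolding c_def using that by (subst if_P) auto
    ultimately show ?thesis by simp arith
  qed
  have "c < 2" by (auto simp: c_def)
  have "proper_colouring {..<Suc n} E 2 (f(n := c))"
    unfolding proper_colouring_def
  proof (intro conjI ballI impI)
    fix v assume "v \<in> {..<Suc n}"
    then show "(f(n := c)) v < 2" using f \<open>c < 2\<close> by (auto simp: proper_colouring_def less_Suc_eq)
  next
    fix u v assume uv: "u \<in> {..<Suc n}" "v \<in> {..<Suc n}" "{u, v} \<in> E"
    then consider "u = n" "v < n" | "u < n" "v = n" | "u < n" "v < n" 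
      using nosing by (cases "u = n"; cases "v = n") auto
    then show "(f(n := c)) u \<noteq> (f(n := c)) v"
    proof cases
      case 1
      with c[of v] uv(3) show ?thesis by (simp add: insert_commute)
    next
      case 2
      with c[of u] uv(3) show ?thesis by simp
    next
      case 3
      with f uv(3) show ?thesis by (simp add: proper_colouring_def)
    qed
  qed
  then show ?case by blast
qed

lemma chromatic_number_le:
  assumes "proper_colouring V E c f"
  shows "chromatic_number V E \<le> c"
  unfolding chromatic_number_def using assms by (intro Least_le) blast

lemma proper_colouring_subset:
  assumes "proper_colouring V E c f" "V' \<subseteq> V" "E' \<subseteq> E"
  shows "proper_colouring V' E' c f"
  using assms unfolding proper_colouring_def by blast

text \<open>Pigeonhole: \<open>k\<close> colour classes of at most \<open>r - 1\<close> vertices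
  cannot cover all \<open>n\<close>, and a class with \<open>r\<close> vertices would contain an
  edge of \<open>E\<close>.\<close>

lemma chromatic_number_gt:
  assumes E: "E \<subseteq> complete_edges {..<n}" and "(r - 1) * k < n"
    and indep: "\<And>A. A \<subseteq> {..<n} \<Longrightarrow> card A = r \<Longrightarrow> complete_edges A \<inter> E \<noteq> {}"
  shows "chromatic_number {..<n} E > k"
proof (rule ccontr)
  assume "\<not> ?thesis"
  then have le: "chromatic_number {..<n} E \<le> k" by simp
  have "card {v, v} \<noteq> 2" for v :: nat by simp
  then have "{v, v} \<notin> E" for v using E unfolding complete_edges_eq by blast
  \<comment> \<open>Giving all vertices distinct colours shows that the \<open>LEAST\<close> in the
    chromatic number is attained.\<close>
  then have "proper_colouring {..<n} E n (\<lambda>v. v)"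
    unfolding proper_colouring_def by auto
  then have "\<exists>f. proper_colouring {..<n} E (chromatic_number {..<n} E) f"
    unfolding chromatic_number_def by (intro LeastI[of "\<lambda>c. \<exists>f. proper_colouring {..<n} E c f" n]) blast
  then obtain f where f: "proper_colouring {..<n} E (chromatic_number {..<n} E) f" by blast
  have "\<exists>c<k. card {v \<in> {..<n}. f v = c} \<ge> r"
  proof (rule ccontr)
    assume "\<not> ?thesis"
    then have *: "card {v \<in> {..<n}. f v = c} \<le> r - 1" if "c < k" for c
      using that by fastforce
    have "{..<n} = (\<Union>c<k. {v \<in> {..<n}. f v = c})"
      using f le unfolding proper_colouring_def by (blast intro: less_le_trans)
    from arg_cong[OF this, of card]
    have "n = card (\<Union>c<k. {v \<in> {..<n}. f v = c})" by (simp only: card_lessThan)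
    also have "\<dots> \<le> (\<Sum>c<k. card {v \<in> {..<n}. f v = c})" by (rule card_UN_le) simp
    also have "\<dots> \<le> (\<Sum>c<k. r - 1)" using * by (intro sum_mono) auto
    finally show False using assms(2) by (simp add: mult.commute)
  qed
  then obtain c where "card {v \<in> {..<n}. f v = c} \<ge> r" by blast
  then obtain A where A: "A \<subseteq> {v \<in> {..<n}. f v = c}" "card A = r"
    by (rule obtain_subset_with_card_n)
  then obtain e where e: "e \<in> complete_edges A" "e \<in> E" using indep[of A] by blast
  then obtain u v where uv: "e = {u, v}" "u \<in> A" "v \<in> A" unfolding complete_edges_def by blast
  then have mem: "u \<in> {..<n}" "v \<in> {..<n}" "f u = c" "f v = c" using A(1) by auto
  have "\<forall>u\<in>{..<n}. \<forall>v\<in>{..<n}. {u, v} \<in> E \<longrightarrow> f u \<noteq> f v"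
    using f by (simp add: proper_colouring_def)
  from this[rule_format, OF mem(1,2)] e(2) uv(1) mem(3,4) show False by simp
qed

section \<open>Upper bound\<close>

lemma finite_complete_edges: "finite V \<Longrightarrow> finite (complete_edges V)"
  by (simp add: complete_edges_eq)

lemma COL_winning_set: "F \<in> snd (COL n k) \<Longrightarrow> F \<subseteq> fst (COL n k)"
  by (force simp: COL_def complete_edges_eq)

lemma COL_upper:
  assumes "n \<le> (b + 1) ^ s" "k \<ge> 2"
  shows "\<not> maker_can_ensure (COL n k) b s"
proof
  let ?H = "COL n k"
  assume "maker_can_ensure ?H b s"
  then obtain \<sigma> where \<sigma>: "legal_strategy ?H \<sigma>"
    "\<And>h. game_play ?H b \<sigma> h \<Longrightarrow> length h \<le> s \<Longrightarrow> current_winning_sets ?H h \<noteq> {}"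
    unfolding maker_can_ensure_def by blast
  have fst: "fst ?H = complete_edges {..<n}" by (simp add: COL_def)
  have fin: "finite (fst ?H)" by (simp add: fst finite_complete_edges)
  have "card {e \<in> fst ?H. Max e = v} \<le> (b + 1) ^ s" for v
  proof -
    \<comment> \<open>An edge with larger endpoint \<open>v\<close> is determined by its other
      endpoint, so a class has at most \<open>n\<close> edges.\<close>
    have "{e \<in> fst ?H. Max e = v} \<subseteq> (\<lambda>u. {u, v}) ` {..<n}"
    proof
      fix e assume "e \<in> {e \<in> fst ?H. Max e = v}"
      then obtain x y where e: "e = {x, y}" "x < n" "y < n" "max x y = v"
        by (auto simp: fst complete_edges_def)
      then show "e \<in> (\<lambda>u. {u, v}) ` {..<n}"
        by (cases "x \<le> y") (auto simp: insert_commute)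
    qed
    then have "card {e \<in> fst ?H. Max e = v} \<le> card {..<n}"
      using surj_card_le by blast
    then show ?thesis using assms(1) by simp
  qed
  from breaker_game[OF fin \<sigma>(1) this order.refl \<sigma>(2)]
  obtain h where h: "game_play ?H b \<sigma> h" "length h = s"
    and board: "\<forall>v. card {e \<in> current_board ?H h. Max e = v} \<le> (b + 1) ^ (s - s)" by blast
  have "current_winning_sets ?H h = {F \<in> snd ?H. F \<subseteq> current_board ?H h}"
    by (rule current_winning_sets_eq[OF h(1) COL_winning_set])
  with \<sigma>(2)[OF h(1)] h(2) obtain F where F: "F \<in> snd ?H" "F \<subseteq> current_board ?H h" by auto
  then obtain V where V: "V \<subseteq> {..<n}" "F \<subseteq> complete_edges V" "chromatic_number V F > k"
    by (auto simp: COL_def)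
  have finF: "finite F" 
    using finite_subset[OF V(2) finite_complete_edges[OF finite_subset[OF V(1)]]] by simp
  have "card {e \<in> F. Max e = v} \<le> 1" for v
  proof -
    have "card {e \<in> F. Max e = v} \<le> card {e \<in> current_board ?H h. Max e = v}"
      using F(2) finite_current_board[OF fin, of h] by (intro card_mono) auto
    with board[rule_format, of v] show ?thesis by simp
  qed
  moreover have "card e = 2" if "e \<in> F" for e using V(2) that by (auto simp: complete_edges_eq)
  ultimately obtain f where "proper_colouring {..<n} F 2 f"
    using two_colourable[OF _ finF] by blast
  then have "chromatic_number V F \<le> 2"
    by (rule chromatic_number_le[OF proper_colouring_subset[OF _ V(1) order.refl]])
  with V(3) assms(2) show False by simp
qed

section \<open>Maker's potential strategy\<close>

text \<open>The base \<open>2 - q ^ b\<close> for Maker's elements makes her gain from one move balance the growth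
  factor \<open>q ^ b\<close> that \<open>b\<close> elements of Breaker can cause.\<close>

definition weight :: "real \<Rightarrow> 'a stage \<Rightarrow> 'a set \<Rightarrow> nat \<Rightarrow> real" where
  "weight q rs F b = q ^ card (F \<inter> breaker_set rs) * (2 - q ^ b) ^ card (F \<inter> maker_set rs)"

text \<open>Since \<open>2 - q ^ b = 1 - (q ^ b - 1)\<close>, claiming an unclaimed \<open>e\<close>
  lets Maker lower the potential by exactly \<open>q ^ b - 1\<close> times this quantity.\<close>

definition danger :: "real \<Rightarrow> nat \<Rightarrow> 'a set set \<Rightarrow> 'a stage \<Rightarrow> 'a \<Rightarrow> real" where
  "danger q b \<G> rs e = (\<Sum>F | F \<in> \<G> \<and> e \<in> F. weight q rs F b)"

text \<open>Convexity of \<open>j \<mapsto> q ^ j\<close>: on \<open>{0..b}\<close> it lies below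
  its chord. Later increments are at least the average of the first \<open>j\<close>.\<close>

lemma power_diff_one_le:
  fixes q :: real
  assumes "q \<ge> 1" "j \<le> b"
  shows "real b * (q ^ j - 1) \<le> real j * (q ^ b - 1)"
  using assms(2)
proof (induction b rule: dec_induct)
  case (step b)
  have "q ^ j - 1 = (q - 1) * (\<Sum>i<j. q ^ i)" by (rule power_diff_1_eq)
  also have "\<dots> \<le> (q - 1) * (\<Sum>i<j. q ^ b)"
    using assms(1) step.hyps by (intro mult_left_mono sum_mono power_increasing) auto
  finally have "q ^ j - 1 \<le> real j * (q ^ Suc b - q ^ b)" by (simp add: algebra_simps)
  with step.IH show ?case by (simp add: algebra_simps)
qed simp

text \<open>The chord bound makes Breaker's reply linear: each of his elements in \<open>F\<close>
  is charged a \<open>b\<close>-th of the weight before the turn, which can be compared directly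
  with Maker's gain.\<close>

lemma weight_turn:
  assumes q: "q \<ge> 1" "q ^ b \<le> 2" and fin: "finite (breaker_set rs)" "finite B" "card B \<le> b"
    and m: "m \<notin> maker_set rs" and B: "B \<inter> breaker_set rs = {}" and "b \<ge> 1"
  shows "weight q (rs @ [(m, B)]) F b \<le> weight q rs F b +
    (q ^ b - 1) * ((\<Sum>e\<in>B. if e \<in> F then weight q rs F b / b else 0) -
      (if m \<in> F then weight q rs F b else 0))"
proof -
  define w where "w = weight q rs F b"
  define j where "j = card (F \<inter> B)"
  have w: "w \<ge> 0" using q by (simp add: w_def weight_def)
  have "j \<le> b" using card_mono[OF fin(2), of "F \<inter> B"] fin(3) by (simp add: j_def)
  then have qj: "q ^ j \<le> 1 + (q ^ b - 1) * (j / b)"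
    using power_diff_one_le[OF q(1), of j b] \<open>b \<ge> 1\<close> by (simp add: field_simps)
  have "F \<inter> (B \<union> breaker_set rs) = (F \<inter> B) \<union> (F \<inter> breaker_set rs)" by blast
  then have cb: "card (F \<inter> (B \<union> breaker_set rs)) = j + card (F \<inter> breaker_set rs)"
    using B fin unfolding j_def by (subst card_Un_disjoint[symmetric]) auto
  have "card (F \<inter> insert m (maker_set rs)) = card (F \<inter> maker_set rs) + (if m \<in> F then 1 else 0)"
    using m by simp
  with cb have eq: "weight q (rs @ [(m, B)]) F b = w * (q ^ j * (if m \<in> F then 2 - q ^ b else 1))"
    by (simp add: w_def weight_def power_add algebra_simps)
  have "q ^ j * (if m \<in> F then 2 - q ^ b else 1) \<le>
      1 + (q ^ b - 1) * (j / b - (if m \<in> F then 1 else 0))"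
  proof (cases "m \<in> F")
    case True
    define x where "x = real j / real b"
    have "q ^ j * (2 - q ^ b) \<le> (1 + (q ^ b - 1) * x) * (2 - q ^ b)"
      using qj q(2) unfolding x_def by (intro mult_right_mono) auto
    also have "\<dots> = 1 + (q ^ b - 1) * (x - 1) - (q ^ b - 1) * (q ^ b - 1) * x"
      by (simp add: algebra_simps)
    \<comment> \<open>The discarded product of Maker's and Breaker's effects on the same set is
      nonnegative, hence in Maker's favour.\<close>
    also have "\<dots> \<le> 1 + (q ^ b - 1) * (j / b - 1)" by (simp add: x_def)
    finally show ?thesis using True by simp
  qed (use qj in simp)
  from mult_left_mono[OF this w]
  have "weight q (rs @ [(m, B)]) F b \<le> w + (q ^ b - 1) * (j * (w / b) - (if m \<in> F then w else 0))"
    unfolding eq by (simp add: algebra_simps split: if_splits)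
  also have "j * (w / b) = (\<Sum>e\<in>B. if e \<in> F then w / b else 0)"
    using fin(2) by (simp add: j_def sum.If_cases Int_commute)
  finally show ?thesis unfolding w_def .
qed

text \<open>Summing \<open>weight_turn\<close> over \<open>\<G>\<close> and swapping sums, Breaker's
  charge is the total danger of \<open>B\<close> divided by \<open>b\<close>. At most
  \<open>b\<close> elements, none more dangerous than \<open>m\<close>, cannot exceed Maker's
  gain.\<close>

lemma potential_turn:
  assumes q: "q \<ge> 1" "q ^ b \<le> 2" and "b \<ge> 1" and fin: "finite (breaker_set rs)" "finite B" "card B \<le> b"
    and m: "m \<notin> maker_set rs" and B: "B \<inter> breaker_set rs = {}" and "finite \<G>"
    and greedy: "\<And>e. e \<in> B \<Longrightarrow> danger q b \<G> rs e \<le> danger q b \<G> rs m"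
  shows "(\<Sum>F\<in>\<G>. weight q (rs @ [(m, B)]) F b) \<le> (\<Sum>F\<in>\<G>. weight q rs F b)"
proof -
  let ?w = "\<lambda>F. weight q rs F b" and ?d = "danger q b \<G> rs"
  have d: "?d e = (\<Sum>F\<in>\<G>. if e \<in> F then ?w F else 0)" for e
    using \<open>finite \<G>\<close> by (simp add: danger_def sum.If_cases Int_def)
  have "?d m \<ge> 0" using q by (auto simp: danger_def weight_def intro!: sum_nonneg)
  have "(\<Sum>F\<in>\<G>. \<Sum>e\<in>B. if e \<in> F then ?w F / b else 0) = (\<Sum>e\<in>B. ?d e) / b"
    unfolding d by (subst sum.swap) (auto simp: sum_divide_distrib intro!: sum.cong)
  also have "\<dots> \<le> (card B * ?d m) / b"
    using sum_mono[of B ?d "\<lambda>_. ?d m"] greedy by (intro divide_right_mono) auto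
  also have "\<dots> \<le> ?d m"
    using fin(3) \<open>b \<ge> 1\<close> \<open>?d m \<ge> 0\<close> by (simp add: divide_le_eq mult.commute[of _ "real b"] mult_right_mono)
  finally have le: "(\<Sum>F\<in>\<G>. \<Sum>e\<in>B. if e \<in> F then ?w F / b else 0) - ?d m \<le> 0" by simp
  have "(\<Sum>F\<in>\<G>. weight q (rs @ [(m, B)]) F b) \<le> (\<Sum>F\<in>\<G>. ?w F +
      (q ^ b - 1) * ((\<Sum>e\<in>B. if e \<in> F then ?w F / b else 0) - (if m \<in> F then ?w F else 0)))"
    by (intro sum_mono weight_turn assms)
  also have "\<dots> = (\<Sum>F\<in>\<G>. ?w F) +
      (q ^ b - 1) * ((\<Sum>F\<in>\<G>. \<Sum>e\<in>B. if e \<in> F then ?w F / b else 0) - ?d m)"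
    by (simp add: d sum.distrib sum_subtractf flip: sum_distrib_left)
  also have "\<dots> \<le> (\<Sum>F\<in>\<G>. ?w F)"
    using le q by (simp add: mult_nonneg_nonpos one_le_power)
  finally show ?thesis .
qed

definition greedy_move :: "real \<Rightarrow> nat \<Rightarrow> 'a set set \<Rightarrow> 'a set \<Rightarrow> 'a stage \<Rightarrow> 'a" where
  "greedy_move q b \<G> X rs =
    (SOME m. m \<in> unclaimed X rs \<and> (\<forall>e\<in>unclaimed X rs. danger q b \<G> rs e \<le> danger q b \<G> rs m))"

lemma greedy_move:
  assumes "finite X" "unclaimed X rs \<noteq> {}"
  shows "greedy_move q b \<G> X rs \<in> unclaimed X rs"
    "e \<in> unclaimed X rs \<Longrightarrow> danger q b \<G> rs e \<le> danger q b \<G> rs (greedy_move q b \<G> X rs)"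
proof -
  let ?U = "unclaimed X rs"
  have "finite ?U" using assms(1) by (simp add: unclaimed_def)
  then have fin: "finite (danger q b \<G> rs ` ?U)" by simp
  moreover have "danger q b \<G> rs ` ?U \<noteq> {}" using assms(2) by simp
  ultimately have "Max (danger q b \<G> rs ` ?U) \<in> danger q b \<G> rs ` ?U" by (rule Max_in)
  then obtain m where m: "m \<in> ?U" "Max (danger q b \<G> rs ` ?U) = danger q b \<G> rs m" by blast
  have "danger q b \<G> rs e \<le> danger q b \<G> rs m" if "e \<in> ?U" for e
    using Max_ge[OF fin imageI[OF that]] m(2) by simp
  with m(1) have "\<exists>m. m \<in> ?U \<and> (\<forall>e\<in>?U. danger q b \<G> rs e \<le> danger q b \<G> rs m)" by blast
  from someI_ex[OF this, folded greedy_move_def]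
  show "greedy_move q b \<G> X rs \<in> ?U"
    "e \<in> ?U \<Longrightarrow> danger q b \<G> rs e \<le> danger q b \<G> rs (greedy_move q b \<G> X rs)" by auto
qed

lemma greedy_potential:
  assumes "stage_play b X (greedy_move q b \<G> X) rs" "finite X" "finite \<G>" "b \<ge> 1" "q \<ge> 1" "q ^ b \<le> 2"
  shows "(\<Sum>F\<in>\<G>. weight q rs F b) \<le> card \<G>"
  using assms(1)
proof induction
  case start
  then show ?case by (simp add: weight_def)
next
  case (turn rs m B)
  have "(\<Sum>F\<in>\<G>. weight q (rs @ [(m, B)]) F b) \<le> (\<Sum>F\<in>\<G>. weight q rs F b)"
  proof (rule potential_turn)
    show "danger q b \<G> rs e \<le> danger q b \<G> rs m" if "e \<in> B" for e
      using greedy_move(2)[OF assms(2), of rs e q b \<G>] that turn.hyps by auto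
  qed (use assms turn.hyps stage_playD(1) in \<open>auto simp: unclaimed_def\<close>)
  with turn.IH show ?case by simp
qed

text \<open>A single weight is at most the total potential, which never exceeds its initial value
  \<open>card \<G>\<close>. Taking logarithms bounds Breaker's share of \<open>F\<close> by
  \<open>b * L + b * c * M\<close>. Adding \<open>L\<close> on both sides lets the estimate be
  iterated by multiplication.\<close>

lemma greedy_stage:
  fixes c L \<mu> :: real
  assumes play: "stage_play b X (greedy_move (root b (1 + \<mu>)) b \<G> X) rs" "unclaimed X rs = {}"
    and fin: "finite X" "finite \<G>" and "b \<ge> 1" and \<mu>: "0 < \<mu>" "\<mu> < 1"
    and c: "c \<ge> 1" "- ln (1 - \<mu>) \<le> c * ln (1 + \<mu>)" and F: "F \<in> \<G>"
    and L: "L = ln (card \<G>) / ln (1 + \<mu>)"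
  shows "card (F \<inter> X) + L \<le> c * (b + 1) * (card (F \<inter> maker_set rs) + L)"
proof -
  \<comment> \<open>Then \<open>q ^ b = 1 + \<mu>\<close>, and Maker's base \<open>2 - q ^ b\<close>
    is \<open>1 - \<mu>\<close>.\<close>
  define q where "q = root b (1 + \<mu>)"
  define M B where "M = card (F \<inter> maker_set rs)" and "B = card (F \<inter> breaker_set rs)"
  have qb: "q ^ b = 1 + \<mu>" using \<open>b \<ge> 1\<close> \<mu> by (simp add: q_def)
  have q1: "q \<ge> 1" using \<open>b \<ge> 1\<close> \<mu> by (simp add: q_def)
  have lnq: "ln q = ln (1 + \<mu>) / b" using \<open>b \<ge> 1\<close> \<mu> by (simp add: q_def ln_root)
  have l: "ln (1 + \<mu>) > 0" using \<mu> by simp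
  have N: "card \<G> \<ge> 1" using F fin(2) by (metis One_nat_def Suc_leI card_gt_0_iff empty_iff)
  then have L0: "L \<ge> 0" using l by (simp add: L)
  have pos: "q ^ B * (1 - \<mu>) ^ M > 0" using q1 \<mu> by simp
  have "q ^ B * (1 - \<mu>) ^ M = weight q rs F b" by (simp add: weight_def M_def B_def qb)
  also have "\<dots> \<le> (\<Sum>F\<in>\<G>. weight q rs F b)"
    using F fin(2) q1 qb \<mu> by (intro member_le_sum) (auto simp: weight_def)
  also have "\<dots> \<le> card \<G>"
    using greedy_potential[OF play(1)[folded q_def] fin \<open>b \<ge> 1\<close> q1] qb \<mu> by simp
  finally have "ln (q ^ B * (1 - \<mu>) ^ M) \<le> ln (card \<G>)" using pos N by (simp add: ln_le_cancel_iff)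
  then have "B * ln (1 + \<mu>) / b \<le> L * ln (1 + \<mu>) + M * (- ln (1 - \<mu>))"
    using q1 \<mu> l by (simp add: ln_mult ln_realpow lnq L)
  also have "\<dots> \<le> L * ln (1 + \<mu>) + M * (c * ln (1 + \<mu>))"
    using c(2) by (intro add_left_mono mult_left_mono) auto
  finally have "ln (1 + \<mu>) * (B / b) \<le> ln (1 + \<mu>) * (L + M * c)" by (simp add: algebra_simps)
  then have "B / b \<le> L + M * c" using l by (rule mult_left_le_imp_le)
  then have *: "B \<le> b * L + b * c * M" using \<open>b \<ge> 1\<close> by (simp add: field_simps)
  have "F \<inter> X = (F \<inter> maker_set rs) \<union> (F \<inter> breaker_set rs)"
    using play(2) stage_playD(2,3)[OF play(1)] by (auto simp: unclaimed_def)
  then have "card (F \<inter> X) = M + B" unfolding M_def B_def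
    using stage_playD(1,4)[OF play(1)] by (subst card_Un_disjoint[symmetric]) auto
  then have "card (F \<inter> X) + L \<le> (1 :: real) * M + (b * c * M + 1 * ((b + 1) * L))" using * by (simp add: algebra_simps)
  also have "\<dots> \<le> c * M + (b * c * M + c * ((b + 1) * L))"
    using c(1) L0 by (intro add_mono mult_right_mono) auto
  finally show ?thesis by (simp add: M_def algebra_simps)
qed

text \<open>The same family \<open>\<G>\<close> serves in every stage, with the potential restarted
  on the current board. The stage estimates multiply, so a set missing the board would have
  \<open>card F + L \<le> a ^ s * L\<close>, against \<open>large\<close>.\<close>

lemma maker_game:
  fixes c \<mu> :: real
  assumes fin: "finite (fst H)" "finite \<G>" and "b \<ge> 1" and \<mu>: "0 < \<mu>" "\<mu> < 1"
    and c: "c \<ge> 1" "- ln (1 - \<mu>) \<le> c * ln (1 + \<mu>)"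
    and large: "\<And>F. F \<in> \<G> \<Longrightarrow> F \<subseteq> fst H \<and> (c * (b + 1)) ^ s * (ln (card \<G>) / ln (1 + \<mu>)) < card F"
  obtains \<sigma> where "legal_strategy H \<sigma>"
    "\<And>h F. game_play H b \<sigma> h \<Longrightarrow> length h \<le> s \<Longrightarrow> F \<in> \<G> \<Longrightarrow> F \<inter> current_board H h \<noteq> {}"
proof
  define \<sigma> where "\<sigma> = (\<lambda>h. greedy_move (root b (1 + \<mu>)) b \<G> (current_board H h))"
  define L where "L = ln (card \<G>) / ln (1 + \<mu>)"
  define a where "a = c * (real b + 1)"
  show "legal_strategy H \<sigma>"
    using greedy_move(1)[OF finite_current_board[OF fin(1)]] by (simp add: legal_strategy_def \<sigma>_def)
  have a: "a \<ge> 1" using mult_mono[of 1 c 1 "real b + 1"] c by (simp add: a_def)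
  fix h F assume h: "game_play H b \<sigma> h" "length h \<le> s" and F: "F \<in> \<G>"
  have N: "card \<G> \<ge> 1" using F fin(2) by (metis One_nat_def Suc_leI card_gt_0_iff empty_iff)
  then have L0: "L \<ge> 0" using \<mu> by (simp add: L_def)
  from h(1) have "card F + L \<le> a ^ length h * (card (F \<inter> current_board H h) + L)"
  proof induction
    case start
    have "F \<inter> fst H = F" using large[OF F] by blast
    then show ?case by simp
  next
    case (stage h rs)
    have "card (F \<inter> current_board H h) + L \<le> a * (card (F \<inter> maker_set rs) + L)" unfolding a_def
      using greedy_stage[OF stage.hyps(3)[unfolded \<sigma>_def] stage.hyps(4) finite_current_board[OF fin(1)]
          fin(2) \<open>b \<ge> 1\<close> \<mu> c F L_def] by (simp add: add.commute)
    then have "a ^ length h * (card (F \<inter> current_board H h) + L)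
        \<le> a ^ length h * (a * (card (F \<inter> maker_set rs) + L))"
      using a by (intro mult_left_mono) auto
    with stage.IH show ?case by (simp add: mult.left_commute mult.assoc)
  qed
  also have "\<dots> \<le> a ^ s * (card (F \<inter> current_board H h) + L)"
    using a h(2) L0 by (intro mult_right_mono power_increasing) auto
  finally have *: "card F + L \<le> a ^ s * (card (F \<inter> current_board H h) + L)" .
  show "F \<inter> current_board H h \<noteq> {}"
  proof
    assume "F \<inter> current_board H h = {}"
    with * have "card F + L \<le> a ^ s * L" by simp
    with large[OF F] L0 show False by (simp add: a_def L_def add.commute)
  qed
qed

section \<open>Lower bound\<close>

lemma COL_lower:
  fixes c \<mu> :: real and b n r s :: nat
  assumes "b \<ge> 1" and \<mu>: "0 < \<mu>" "\<mu> < 1" and c: "c \<ge> 1" "- ln (1 - \<mu>) \<le> c * ln (1 + \<mu>)"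
    and r: "(r - 1) * k < n" "(c * (real b + 1)) ^ s * (n / ln (1 + \<mu>)) < real (r choose 2)"
  shows "maker_can_ensure (COL n k) b s"
proof -
  let ?H = "COL n k"
  define \<G> where "\<G> = complete_edges ` {A. A \<subseteq> {..<n} \<and> card A = r}"
  have fst: "fst ?H = complete_edges {..<n}" by (simp add: COL_def)
  have fin: "finite (fst ?H)" by (simp add: fst finite_complete_edges)
  have fin\<G>: "finite \<G>" by (simp add: \<G>_def)
  have "card \<G> \<le> card {A. A \<subseteq> {..<n} \<and> card A = r}" unfolding \<G>_def by (rule card_image_le) simp
  also have "\<dots> \<le> card (Pow {..<n})" by (intro card_mono) auto
  finally have N: "card \<G> \<le> 2 ^ n" by (simp add: card_Pow)
  have "F \<subseteq> fst ?H \<and> (c * (real b + 1)) ^ s * (ln (card \<G>) / ln (1 + \<mu>)) < card F" if F: "F \<in> \<G>" for F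
  proof
    obtain A where A: "F = complete_edges A" "A \<subseteq> {..<n}" "card A = r"
      using F by (auto simp: \<G>_def)
    then show "F \<subseteq> fst ?H" by (auto simp: fst complete_edges_eq)
    have "finite A" using A(2) finite_subset by blast
    then have cF: "card F = r choose 2" using A by (simp add: complete_edges_eq n_subsets)
    have "card \<G> > 0" using F fin\<G> by (auto simp: card_gt_0_iff)
    then have "ln (card \<G>) \<le> ln (2 ^ n)" using N by (simp add: numeral_power_le_of_nat_cancel_iff
      of_nat_le_numeral_power_cancel_iff)
    also have "\<dots> = n * ln 2" by (simp add: ln_realpow)
    also have "\<dots> \<le> n * (1 :: real)"
      using ln_le_minus_one[of "2 :: real"] by (intro mult_left_mono) auto
    finally have "(c * (real b + 1)) ^ s * (ln (card \<G>) / ln (1 + \<mu>)) \<le> (c * (real b + 1)) ^ s * (n / ln (1 + \<mu>))"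
      using c \<mu> by (intro mult_left_mono divide_right_mono) auto
    with r(2) show "(c * (real b + 1)) ^ s * (ln (card \<G>) / ln (1 + \<mu>)) < card F" by (simp add: cF)
  qed
  from maker_game[OF fin fin\<G> \<open>b \<ge> 1\<close> \<mu> c this]
  obtain \<sigma> where \<sigma>: "legal_strategy ?H \<sigma>"
    "\<And>h F. game_play ?H b \<sigma> h \<Longrightarrow> length h \<le> s \<Longrightarrow> F \<in> \<G> \<Longrightarrow> F \<inter> current_board ?H h \<noteq> {}"
    by metis
  have "current_winning_sets ?H h \<noteq> {}" if h: "game_play ?H b \<sigma> h" "length h \<le> s" for h
  proof -
    let ?E = "current_board ?H h"
    have sub: "?E \<subseteq> complete_edges {..<n}"
      using h(1) by induction (auto simp: fst dest: stage_playD(2))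
    \<comment> \<open>Maker's whole graph is itself the surviving winning set.\<close>
    have "chromatic_number {..<n} ?E > k"
      using \<sigma>(2)[OF h] by (intro chromatic_number_gt[OF sub r(1)]) (auto simp: \<G>_def)
    then have "?E \<in> snd ?H" using sub by (auto simp: COL_def)
    then show ?thesis using current_winning_sets_eq[OF h(1) COL_winning_set] by auto
  qed
  with \<sigma>(1) show ?thesis unfolding maker_can_ensure_def by blast
qed

section \<open>Bracketing the threshold\<close>

lemma maker_can_ensure_mono:
  "maker_can_ensure H b s \<Longrightarrow> t \<le> s \<Longrightarrow> maker_can_ensure H b t"
  unfolding maker_can_ensure_def by (meson le_trans)

text \<open>By monotonicity a failure at \<open>t\<close> bounds all achievable numbers, which gives
  \<open>GREATEST\<close> its intended meaning.\<close>

lemma threshold_bounds: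
  assumes "maker_can_ensure H b s" "\<not> maker_can_ensure H b t"
  shows "s \<le> \<tau> H b" "\<tau> H b < t"
proof -
  have bd: "u \<le> t" if "maker_can_ensure H b u" for u
  proof (rule ccontr)
    assume "\<not> u \<le> t"
    then have "t \<le> u" by simp
    from maker_can_ensure_mono[OF that this] assms(2) show False by contradiction
  qed
  show "s \<le> \<tau> H b" unfolding threshold_def by (rule Greatest_le_nat[where P = "maker_can_ensure H b", OF assms(1) bd])
  have ens: "maker_can_ensure H b (\<tau> H b)" unfolding threshold_def by (rule GreatestI_nat[where P = "maker_can_ensure H b", OF assms(1) bd])
  with assms(2) have "\<tau> H b \<noteq> t" by metis
  with bd[OF ens] show "\<tau> H b < t" by simp
qed

section \<open>Asymptotics\<close>

text \<open>Allows the loss factor \<open>c\<close> per stage to be arbitrarily close to 1, as the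
  ratio of the two logarithms tends to 1 for \<open>\<mu> \<rightarrow> 0\<close>.\<close>

lemma exists_bias_parameter:
  fixes c :: real
  assumes "c > 1"
  obtains \<mu> :: real where "0 < \<mu>" "\<mu> < 1" "- ln (1 - \<mu>) \<le> c * ln (1 + \<mu>)"
proof
  \<comment> \<open>With this choice the bounds from \<open>ln x \<le> x - 1\<close> on both sides
    meet at \<open>(c - 1) / 2\<close>.\<close>
  define \<mu> where "\<mu> = (c - 1) / (c + 1)"
  show \<mu>: "0 < \<mu>" "\<mu> < 1" using assms by (auto simp: \<mu>_def field_simps)
  have eq: "1 / (1 - \<mu>) = (c + 1) / 2" "1 / (1 + \<mu>) = (c + 1) / (2 * c)"
    using assms by (simp_all add: \<mu>_def field_simps)
  have "- ln (1 - \<mu>) = ln (1 / (1 - \<mu>))" using \<mu> by (simp add: ln_div)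
  also have "\<dots> \<le> 1 / (1 - \<mu>) - 1" using \<mu> by (intro ln_le_minus_one) simp
  also have "\<dots> = c * (1 - 1 / (1 + \<mu>))" unfolding eq using assms by (simp add: field_simps)
  also have "\<dots> \<le> c * ln (1 + \<mu>)"
    using ln_le_minus_one[of "1 / (1 + \<mu>)"] \<mu> assms by (intro mult_left_mono) (auto simp: ln_div)
  finally show "- ln (1 - \<mu>) \<le> c * ln (1 + \<mu>)" .
qed

lemma subpolynomial_eventually:
  assumes "subpolynomial f" "\<epsilon> > 0" "C > 0"
  shows "eventually (\<lambda>n. real (f n) \<le> C * real n powr \<epsilon>) at_top"
proof -
  have "(\<lambda>n. real (f n)) \<in> o(\<lambda>n. real n powr \<epsilon>)" using assms(1,2) by (simp add: subpolynomial_def)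
  from landau_o.smallD[OF this \<open>C > 0\<close>] show ?thesis by simp
qed

lemma log_at_top:
  assumes "subpolynomial b" "\<And>n. b n \<ge> 1"
  shows "filterlim (\<lambda>n. log (real (b n) + 1) (real n)) at_top at_top"
  unfolding filterlim_at_top_gt[where c = 0]
proof (intro allI impI)
  fix Z :: real assume "Z > 0"
  \<comment> \<open>The factor 1/2 absorbs the summand in
    \<open>b n + 1 \<le> 2 * b n\<close>.\<close>
  have "eventually (\<lambda>n. real (b n) \<le> (1 / 2) * real n powr (1 / Z)) at_top"
    using \<open>Z > 0\<close> by (intro subpolynomial_eventually assms) auto
  then show "eventually (\<lambda>n. log (real (b n) + 1) (real n) \<ge> Z) at_top"
    using eventually_gt_at_top[of 0]
  proof eventually_elim
    case (elim n)
    have b: "real (b n) \<ge> 1" using assms(2)[of n] by simp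
    then have "real (b n) + 1 \<le> real n powr (1 / Z)" using elim by linarith
    then have "ln (real (b n) + 1) \<le> ln (real n powr (1 / Z))" using b elim by (subst ln_le_cancel_iff) auto
    also have "\<dots> = ln (real n) / Z" using elim by (simp add: ln_powr)
    finally show ?case using b \<open>Z > 0\<close> by (simp add: log_def field_simps)
  qed
qed

text \<open>Exponent budget: \<open>1 - \<epsilon>\<close> for \<open>(b + 1) ^ s\<close>,
  \<open>\<epsilon> / 4\<close> for \<open>c ^ s\<close> and \<open>\<epsilon> / 2\<close> for the
  square of \<open>k\<close> leave \<open>1 - \<epsilon> / 4\<close>, which is below the exponent 1
  that is available.\<close>

lemma threshold_lower:
  assumes b: "\<And>n. b n \<ge> 1" and k: "\<And>n. k n \<ge> 2" and sk: "subpolynomial k" and \<epsilon>: "0 < \<epsilon>" "\<epsilon> < 1"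
  shows "eventually (\<lambda>n. maker_can_ensure (COL n (k n)) (b n)
    (nat \<lfloor>(1 - \<epsilon>) * log (real (b n) + 1) (real n)\<rfloor>)) at_top"
proof -
  \<comment> \<open>Since \<open>b n + 1 \<ge> 2\<close>, this fixed \<open>c\<close> satisfies
    \<open>c \<le> (b n + 1) powr (\<epsilon> / 4)\<close> for every \<open>n\<close>.\<close>
  define c :: real where "c = 2 powr (\<epsilon> / 4)"
  have "c > 1" using \<epsilon> by (simp add: c_def)
  then obtain \<mu> :: real where \<mu>: "0 < \<mu>" "\<mu> < 1" "- ln (1 - \<mu>) \<le> c * ln (1 + \<mu>)"
    by (rule exists_bias_parameter)
  \<comment> \<open>The 5 leaves strict room below the 4 that comes from \<open>r choose 2\<close>
    being at least a quarter of the square of \<open>n / k\<close>.\<close>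
  define C where "C = sqrt (ln (1 + \<mu>) / 5)"
  have C: "C > 0" "C\<^sup>2 = ln (1 + \<mu>) / 5" using \<mu> by (simp_all add: C_def)
  have "eventually (\<lambda>n. real (k n) \<le> C * real n powr (\<epsilon> / 4)) at_top"
    using \<epsilon> C by (intro subpolynomial_eventually sk) auto
  \<comment> \<open>Ensures \<open>n / k \<ge> 2\<close>, hence \<open>r \<ge> 2\<close>, so that
    \<open>r choose 2\<close> is at least a quarter of the square of \<open>r\<close>.\<close>
  moreover have "eventually (\<lambda>n. real (k n) \<le> (1 / 2) * real n powr (1 / 2)) at_top"
    by (intro subpolynomial_eventually sk) auto
  ultimately show ?thesis using eventually_gt_at_top[of 1]
  proof eventually_elim
    case (elim n)
    define l where "l = log (real (b n) + 1) (real n)"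
    define s where "s = nat \<lfloor>(1 - \<epsilon>) * l\<rfloor>"
    define r where "r = nat \<lceil>real n / real (k n)\<rceil>"
    have n: "real n > 1" using elim by simp
    have bn: "real (b n) \<ge> 1" using b[of n] by simp
    have kn: "real (k n) \<ge> 2" using k[of n] by simp
    have l: "l > 0" using n bn by (simp add: l_def)
    have bl: "(real (b n) + 1) powr l = real n" using n bn by (simp add: l_def)
    have s: "real s \<le> (1 - \<epsilon>) * l" using l \<epsilon> by (simp add: s_def)
    have "(real (b n) + 1) ^ s = (real (b n) + 1) powr s" using bn by (simp add: powr_realpow)
    also have "\<dots> \<le> (real (b n) + 1) powr (l * (1 - \<epsilon>))"
      using s bn by (intro powr_mono) (auto simp: mult.commute)
    also have "\<dots> = real n powr (1 - \<epsilon>)" by (simp only: bl flip: powr_powr)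
    finally have 1: "(real (b n) + 1) ^ s \<le> real n powr (1 - \<epsilon>)" .
    have "c ^ s = 2 powr (\<epsilon> / 4 * s)" by (simp add: c_def powr_powr flip: powr_realpow)
    also have "\<dots> \<le> (real (b n) + 1) powr (\<epsilon> / 4 * s)"
      using bn \<epsilon> by (intro powr_mono2) auto
    also have "\<dots> \<le> (real (b n) + 1) powr (l * (\<epsilon> / 4))"
    proof -
      have "(1 - \<epsilon>) * l \<le> 1 * l" using \<epsilon> l by (intro mult_right_mono) auto
      with s have "real s \<le> l" by linarith
      then show ?thesis using bn \<epsilon> by (intro powr_mono) auto
    qed
    also have "\<dots> = real n powr (\<epsilon> / 4)" by (simp only: bl flip: powr_powr)
    finally have 2: "c ^ s \<le> real n powr (\<epsilon> / 4)" .
    have "(c * (real (b n) + 1)) ^ s = c ^ s * (real (b n) + 1) ^ s" by (simp add: power_mult_distrib add.commute)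
    also have "\<dots> \<le> real n powr (\<epsilon> / 4) * real n powr (1 - \<epsilon>)"
      using 1 2 \<open>c > 1\<close> by (intro mult_mono) auto
    also have "\<dots> = real n powr (1 - 3 * \<epsilon> / 4)" by (simp flip: powr_add)
    finally have 3: "(c * (real (b n) + 1)) ^ s \<le> real n powr (1 - 3 * \<epsilon> / 4)" .
    have "(real (k n))\<^sup>2 \<le> (C * real n powr (\<epsilon> / 4))\<^sup>2" using elim kn by (intro power_mono) auto
    also have "\<dots> = C\<^sup>2 * real n powr (\<epsilon> / 2)" by (simp add: power_mult_distrib power2_eq_square flip: powr_add)
    finally have k2: "(real (k n))\<^sup>2 \<le> ln (1 + \<mu>) / 5 * real n powr (\<epsilon> / 2)" by (simp add: C)
    have "(c * (real (b n) + 1)) ^ s * (real (k n))\<^sup>2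
        \<le> real n powr (1 - 3 * \<epsilon> / 4) * (ln (1 + \<mu>) / 5 * real n powr (\<epsilon> / 2))"
      using 3 k2 by (intro mult_mono) auto
    also have "\<dots> = ln (1 + \<mu>) / 5 * real n powr (1 - \<epsilon> / 4)" by (simp flip: powr_add)
    also have "\<dots> \<le> ln (1 + \<mu>) / 5 * real n powr 1"
      using n \<epsilon> \<mu> by (intro mult_left_mono powr_mono) auto
    also have "\<dots> < ln (1 + \<mu>) / 4 * n" using n \<mu> by simp
    finally have "(c * (real (b n) + 1)) ^ s * (real (k n))\<^sup>2 < ln (1 + \<mu>) / 4 * n" .
    then have "(c * (real (b n) + 1)) ^ s < ln (1 + \<mu>) / 4 * n / (real (k n))\<^sup>2"
      using kn by (simp add: pos_less_divide_eq)
    then have "(c * (real (b n) + 1)) ^ s * (n / ln (1 + \<mu>))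
        < ln (1 + \<mu>) / 4 * n / (real (k n))\<^sup>2 * (n / ln (1 + \<mu>))"
      using n \<mu> by (intro mult_strict_right_mono) auto
    also have "\<dots> = (real n / real (k n))\<^sup>2 / 4"
      using \<mu> by (simp add: power2_eq_square)
    also have "\<dots> \<le> real (r choose 2)"
    proof -
      have "real n powr (1 / 2) \<le> real n powr 1" using n by (intro powr_mono) auto
      with elim n have "2 * real (k n) \<le> real n" by simp
      then have x: "real n / real (k n) \<ge> 2" using kn by (simp add: field_simps)
      have xr: "real n / real (k n) \<le> real r" unfolding r_def by linarith
      define y where "y = (real n / real (k n))\<^sup>2"
      have "y \<le> (real r)\<^sup>2" unfolding y_def using x xr by (intro power_mono) auto
      moreover have "2 * real r \<le> real r * real r" using x xr by (intro mult_right_mono) linarith+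
      moreover have "2 * (r choose 2) = r * (r - 1)" by (cases r) (simp_all add: choose_two)
      then have "2 * real (r choose 2) = real r * real (r - 1)" by (metis of_nat_mult of_nat_numeral)
      then have "2 * real (r choose 2) = real r * real r - real r"
        using x xr by (simp add: of_nat_diff algebra_simps)
      moreover have "(real r)\<^sup>2 = real r * real r" by (rule power2_eq_square)
      ultimately show ?thesis unfolding y_def[symmetric] by linarith
    qed
    finally have large: "(c * (real (b n) + 1)) ^ s * (n / ln (1 + \<mu>)) < r choose 2" .
    have "real (r - 1) < real n / real (k n)"
    proof -
      have "real n / real (k n) > 0" using n kn by simp
      then show ?thesis unfolding r_def by linarith
    qed
    then have "real ((r - 1) * k n) < real n" using kn by (simp add: field_simps)
    then have "(r - 1) * k n < n" by linarith
    from COL_lower[OF b \<mu>(1,2) _ \<mu>(3) this large] \<open>c > 1\<close>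
    show ?case by (simp add: s_def l_def)
  qed
qed

theorem theorem1p3:
  fixes b k :: "nat \<Rightarrow> nat"
  assumes "\<And>n. b n \<ge> 1"
    and "\<And>n. k n \<ge> 2"
    and "subpolynomial b"
    and "subpolynomial k"
  shows "(\<lambda>n. real (\<tau> (COL n (k n)) (b n))) \<sim>[at_top] (\<lambda>n. log (real (b n) + 1) (real n))"
proof (rule asymp_equivI', rule tendstoI)
  fix e :: real assume "e > 0"
  \<comment> \<open>One \<open>\<epsilon>\<close> pays for \<open>threshold_lower\<close>, a second
    one for rounding down, which costs at most \<open>1 \<le> \<epsilon> * l\<close>.\<close>
  define \<epsilon> where "\<epsilon> = min e 1 / 4"
  have \<epsilon>: "0 < \<epsilon>" "\<epsilon> < 1" "2 * \<epsilon> < e" using \<open>e > 0\<close> by (auto simp: \<epsilon>_def)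
  have "eventually (\<lambda>n. log (real (b n) + 1) (real n) \<ge> 1 / \<epsilon>) at_top"
    using log_at_top[OF assms(3,1)] by (simp add: filterlim_at_top)
  then show "eventually (\<lambda>n. dist (real (\<tau> (COL n (k n)) (b n)) / log (real (b n) + 1) (real n)) 1 < e) at_top"
    using threshold_lower[where b = b, OF assms(1,2,4) \<epsilon>(1,2)] eventually_gt_at_top[of 0]
  proof eventually_elim
    case (elim n)
    define l where "l = log (real (b n) + 1) (real n)"
    define t where "t = nat \<lceil>l\<rceil>"
    have l: "l \<ge> 1 / \<epsilon>" using elim by (simp add: l_def)
    then have l0: "l > 0" using \<epsilon> by (smt (verit) zero_less_divide_1_iff)
    have bn: "real (b n) \<ge> 1" using assms(1)[of n] by simp
    have "real n = (real (b n) + 1) powr l" using elim bn by (simp add: l_def)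
    also have "\<dots> \<le> (real (b n) + 1) powr t" using bn l0 by (intro powr_mono) (auto simp: t_def)
    also have "\<dots> = real ((b n + 1) ^ t)" using bn by (simp add: powr_realpow add.commute)
    finally have "n \<le> (b n + 1) ^ t" by linarith
    from threshold_bounds[OF elim(2) COL_upper[OF this assms(2)]]
    have \<tau>: "nat \<lfloor>(1 - \<epsilon>) * l\<rfloor> \<le> \<tau> (COL n (k n)) (b n)" "\<tau> (COL n (k n)) (b n) < t"
      by (simp_all add: l_def)
    \<comment> \<open>An integer strictly below the ceiling of \<open>l\<close> is below
      \<open>l\<close> itself, so rounding costs nothing here.\<close>
    from \<tau>(2) have up: "real (\<tau> (COL n (k n)) (b n)) < l" unfolding t_def by linarith
    have "(1 - \<epsilon>) * l - 1 \<le> real (\<tau> (COL n (k n)) (b n))" using \<tau>(1) by linarith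
    moreover have "\<epsilon> * l \<ge> 1" using l \<epsilon> by (simp add: field_simps)
    ultimately have "(1 - 2 * \<epsilon>) * l \<le> real (\<tau> (COL n (k n)) (b n))" by (simp add: algebra_simps)
    moreover have "(1 - e) * l < (1 - 2 * \<epsilon>) * l" using \<epsilon> l0 by (intro mult_strict_right_mono) auto
    ultimately have "1 - e < real (\<tau> (COL n (k n)) (b n)) / l" using l0 by (subst pos_less_divide_eq) linarith+
    moreover have "real (\<tau> (COL n (k n)) (b n)) / l < 1" using up l0 by (simp add: divide_less_eq)
    ultimately show ?case unfolding dist_real_def l_def[symmetric] using \<open>e > 0\<close> by linarith
  qed
qed

end
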